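(* Let $\Lambda$ be a proof system in $\mathcal{L}(\Delta)$ having the rule $\text{RE}\Delta$, let $x$ be a maximal consistent set for $\Lambda$, and let $\varphi$ be a formula. Then the following statements are equivalent: (1) For every formula $\psi$ such that $\vdash\varphi\to\psi$, $\Delta\psi\in x$. (2) For every formula $\psi$, $\Delta(\varphi\vee\psi)\in x$.
   Context: Fix a nonempty set $\mathbf{P}$ of propositional variables. The language $\mathcal{L}(\Delta)$ is given by $\varphi::=p\in\mathbf{P}\mid\neg\varphi\mid\varphi\land\varphi\mid\Delta\varphi$; $\vee,\to,\leftrightarrow$ are the usual abbreviations. Proof systems are understood to contain all instances of propositional tautologies as axioms and the rule MP (from $\varphi$ and $\varphi\to\psi$ infer $\psi$). The rule $\text{RE}\Delta$ is: from $\varphi\leftrightarrow\psi$ infer $\Delta\varphi\leftrightarrow\Delta\psi$. $\vdash\varphi$ means that $\varphi$ is a theorem of $\Lambda$. A set $\Gamma$ of formulas is consistent for $\Lambda$ if there are no $\gamma_1,\dots,\gamma_n\in\Gamma$ with $\vdash\neg(\gamma_1\land\dots\land\gamma_n)$, and maximal consistent if it is consistent and no proper superset of it is. *)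

theory Defs
  imports Main
begin

text \<open>The nonempty set of propositional variables is the type \<open>'p\<close>.\<close>

datatype 'p formula =
    Var 'p
  | Neg "'p formula"
  | And "'p formula" "'p formula"
  | Delta "'p formula"

definition Or :: "'p formula \<Rightarrow> 'p formula \<Rightarrow> 'p formula" where
  "Or \<phi> \<psi> = Neg (And (Neg \<phi>) (Neg \<psi>))"

definition Imp :: "'p formula \<Rightarrow> 'p formula \<Rightarrow> 'p formula" where
  "Imp \<phi> \<psi> = Neg (And \<phi> (Neg \<psi>))"

definition Iff :: "'p formula \<Rightarrow> 'p formula \<Rightarrow> 'p formula" where
  "Iff \<phi> \<psi> = And (Imp \<phi> \<psi>) (Imp \<psi> \<phi>)"

text \<open>
  Schemes of classical propositional logic have their own countably infinite supply of
  schematic letters, since \<open>'p\<close> may be finite.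
\<close>

datatype scheme = Letter nat | SNeg scheme | SAnd scheme scheme

primrec seval :: "(nat \<Rightarrow> bool) \<Rightarrow> scheme \<Rightarrow> bool" where
  "seval v (Letter i) = v i"
| "seval v (SNeg s) = (\<not> seval v s)"
| "seval v (SAnd s t) = (seval v s \<and> seval v t)"

primrec sinst :: "(nat \<Rightarrow> 'p formula) \<Rightarrow> scheme \<Rightarrow> 'p formula" where
  "sinst \<sigma> (Letter i) = \<sigma> i"
| "sinst \<sigma> (SNeg s) = Neg (sinst \<sigma> s)"
| "sinst \<sigma> (SAnd s t) = And (sinst \<sigma> s) (sinst \<sigma> t)"

definition tautology :: "scheme \<Rightarrow> bool" where
  "tautology s \<longleftrightarrow> (\<forall>v. seval v s)"

definition tautology_instances :: "'p formula set" where
  "tautology_instances = {sinst \<sigma> s | \<sigma> s. tautology s}"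

text \<open>A rule is the set of its instances, each a list of premises with a conclusion.\<close>

type_synonym 'p rule = "('p formula list \<times> 'p formula) set"

definition MP :: "'p rule" where
  "MP = {([\<phi>, Imp \<phi> \<psi>], \<psi>) | \<phi> \<psi>. True}"

definition RE_Delta :: "'p rule" where
  "RE_Delta = {([Iff \<phi> \<psi>], Iff (Delta \<phi>) (Delta \<psi>)) | \<phi> \<psi>. True}"

record 'p calculus =
  axioms :: "'p formula set"
  rules :: "'p rule set"

definition proof_system :: "'p calculus \<Rightarrow> bool" where
  "proof_system \<Lambda> \<longleftrightarrow> tautology_instances \<subseteq> axioms \<Lambda> \<and> MP \<in> rules \<Lambda>"

inductive provable :: "'p calculus \<Rightarrow> 'p formula \<Rightarrow> bool" (infix \<open>\<turnstile>\<close> 50)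
  for \<Lambda> :: "'p calculus" where
  axiom: "\<phi> \<in> axioms \<Lambda> \<Longrightarrow> \<Lambda> \<turnstile> \<phi>"
| rule: "R \<in> rules \<Lambda> \<Longrightarrow> (\<phi>s, \<psi>) \<in> R \<Longrightarrow> (\<And>\<phi>. \<phi> \<in> set \<phi>s \<Longrightarrow> \<Lambda> \<turnstile> \<phi>) \<Longrightarrow> \<Lambda> \<turnstile> \<psi>"

text \<open>
  Conjunction of the nonempty list \<open>\<gamma> # \<gamma>s\<close>, associated to the right. There is no empty
  conjunction, so the empty set is consistent for every calculus.
\<close>

fun conj_list :: "'p formula \<Rightarrow> 'p formula list \<Rightarrow> 'p formula" where
  "conj_list \<gamma> [] = \<gamma>"
| "conj_list \<gamma> (\<delta> # \<gamma>s) = And \<gamma> (conj_list \<delta> \<gamma>s)"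

definition consistent :: "'p calculus \<Rightarrow> 'p formula set \<Rightarrow> bool" where
  "consistent \<Lambda> \<Gamma> \<longleftrightarrow>
     \<not> (\<exists>\<gamma> \<gamma>s. set (\<gamma> # \<gamma>s) \<subseteq> \<Gamma> \<and> \<Lambda> \<turnstile> Neg (conj_list \<gamma> \<gamma>s))"

definition maximal_consistent :: "'p calculus \<Rightarrow> 'p formula set \<Rightarrow> bool" where
  "maximal_consistent \<Lambda> \<Gamma> \<longleftrightarrow>
     consistent \<Lambda> \<Gamma> \<and> \<not> (\<exists>\<Gamma>'. \<Gamma> \<subset> \<Gamma>' \<and> consistent \<Lambda> \<Gamma>')"

end

theory Submission imports Defs begin

text \<open>
  The key point is that, once \<open>\<phi> \<rightarrow> \<psi>\<close> is a theorem, \<open>\<psi>\<close> is itself provably equivalent to a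
  disjunction with \<open>\<phi>\<close> as a disjunct, namely \<open>\<phi> \<or> \<psi>\<close>; conversely every such disjunction is a
  provable consequence of \<open>\<phi>\<close>. So, up to provable equivalence, both statements put \<open>\<Delta>\<close> in
  front of the same formulas. The rule \<open>RE\<Delta>\<close> carries the equivalence through \<open>\<Delta>\<close>, and
  maximal consistent sets do not distinguish provably equivalent formulas because they are
  closed under provable implication (\<open>maximal_consistent_closed\<close>).

  That closure comes directly from the definition of consistency. If adding \<open>\<beta>\<close>
  makes \<open>x\<close> inconsistent while \<open>\<alpha> \<in> x\<close> and \<open>\<alpha> \<rightarrow> \<beta>\<close> is a theorem, replacing \<open>\<beta>\<close> by the stronger
  \<open>\<alpha>\<close> throughout the refuted conjunction gives a conjunction over \<open>x\<close> that is refuted as well.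
\<close>

abbreviation SImp :: "scheme \<Rightarrow> scheme \<Rightarrow> scheme" where
  "SImp s t \<equiv> SNeg (SAnd s (SNeg t))"

lemma provable_MP:
  assumes "proof_system \<Lambda>" "\<Lambda> \<turnstile> Imp \<phi> \<psi>" "\<Lambda> \<turnstile> \<phi>"
  shows "\<Lambda> \<turnstile> \<psi>"
proof (rule provable.rule)
  show "MP \<in> rules \<Lambda>"
    using assms(1) by (simp add: proof_system_def)
  show "([\<phi>, Imp \<phi> \<psi>], \<psi>) \<in> MP"
    by (auto simp: MP_def)
qed (use assms(2,3) in auto)

lemma provable_tautology:
  assumes "proof_system \<Lambda>" "tautology s"
  shows "\<Lambda> \<turnstile> sinst \<sigma> s"
  using assms by (auto simp: proof_system_def tautology_instances_def intro!: provable.axiom)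

text \<open>
  The propositional steps below are proved semantically: they instantiate the letters of
  a scheme by formulas and check the scheme under all valuations. The next
  two lemmas allow such a step to have premises.
\<close>

lemma provable_consequence:
  assumes "proof_system \<Lambda>" "tautology (SImp s t)" "\<Lambda> \<turnstile> sinst \<sigma> s"
  shows "\<Lambda> \<turnstile> sinst \<sigma> t"
  using provable_MP[OF assms(1) _ assms(3)] provable_tautology[OF assms(1,2), of \<sigma>]
  by (simp add: Imp_def)

lemma provable_consequence2:
  assumes "proof_system \<Lambda>" "tautology (SImp s (SImp t u))" "\<Lambda> \<turnstile> sinst \<sigma> s" "\<Lambda> \<turnstile> sinst \<sigma> t"
  shows "\<Lambda> \<turnstile> sinst \<sigma> u"
  using provable_MP[OF assms(1) _ assms(4)] provable_consequence[OF assms(1-3)]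
  by (simp add: Imp_def)

lemma provable_Imp_refl:
  assumes "proof_system \<Lambda>"
  shows "\<Lambda> \<turnstile> Imp \<phi> \<phi>"
  using provable_tautology[OF assms, of "SImp (Letter 0) (Letter 0)" "\<lambda>_. \<phi>"]
  by (simp add: tautology_def Imp_def)

lemma provable_Imp_Or:
  assumes "proof_system \<Lambda>"
  shows "\<Lambda> \<turnstile> Imp \<phi> (Or \<phi> \<psi>)"
  using provable_tautology[OF assms,
      of "SImp (Letter 0) (SNeg (SAnd (SNeg (Letter 0)) (SNeg (Letter 1))))" "(!) [\<phi>, \<psi>]"]
  by (simp add: tautology_def Imp_def Or_def)

lemma provable_Or_absorb:
  assumes "proof_system \<Lambda>" "\<Lambda> \<turnstile> Imp \<phi> \<psi>"
  shows "\<Lambda> \<turnstile> Iff (Or \<phi> \<psi>) \<psi>"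
proof -
  let ?or = "SNeg (SAnd (SNeg (Letter 0)) (SNeg (Letter 1)))"
  show ?thesis
    using provable_consequence[OF assms(1), of "SImp (Letter 0) (Letter 1)"
        "SAnd (SImp ?or (Letter 1)) (SImp (Letter 1) ?or)" "(!) [\<phi>, \<psi>]"] assms(2)
    by (auto simp: tautology_def Imp_def Or_def Iff_def)
qed

lemma provable_Iff_Imp:
  assumes "proof_system \<Lambda>" "\<Lambda> \<turnstile> Iff \<phi> \<psi>"
  shows "\<Lambda> \<turnstile> Imp \<phi> \<psi>"
  using provable_consequence[OF assms(1),
      of "SAnd (SImp (Letter 0) (Letter 1)) (SImp (Letter 1) (Letter 0))"
        "SImp (Letter 0) (Letter 1)" "(!) [\<phi>, \<psi>]"] assms(2)
  by (simp add: tautology_def Imp_def Iff_def)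

lemma provable_And_mono:
  assumes "proof_system \<Lambda>" "\<Lambda> \<turnstile> Imp \<phi> \<phi>'" "\<Lambda> \<turnstile> Imp \<psi> \<psi>'"
  shows "\<Lambda> \<turnstile> Imp (And \<phi> \<psi>) (And \<phi>' \<psi>')"
  using provable_consequence2[OF assms(1), of "SImp (Letter 0) (Letter 1)"
      "SImp (Letter 2) (Letter 3)"
      "SImp (SAnd (Letter 0) (Letter 2)) (SAnd (Letter 1) (Letter 3))" "(!) [\<phi>, \<phi>', \<psi>, \<psi>']"]
    assms(2,3)
  by (simp add: tautology_def Imp_def)

lemma provable_modus_tollens:
  assumes "proof_system \<Lambda>" "\<Lambda> \<turnstile> Imp \<phi> \<psi>" "\<Lambda> \<turnstile> Neg \<psi>"
  shows "\<Lambda> \<turnstile> Neg \<phi>"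
  using provable_consequence2[OF assms(1), of "SImp (Letter 0) (Letter 1)"
      "SNeg (Letter 1)" "SNeg (Letter 0)" "(!) [\<phi>, \<psi>]"] assms(2,3)
  by (auto simp: tautology_def Imp_def)

lemma provable_conj_list_mono:
  assumes "proof_system \<Lambda>" "\<And>\<gamma>. \<Lambda> \<turnstile> Imp (f \<gamma>) \<gamma>"
  shows "\<Lambda> \<turnstile> Imp (conj_list (f \<gamma>) (map f \<gamma>s)) (conj_list \<gamma> \<gamma>s)"
  by (induction \<gamma> \<gamma>s rule: conj_list.induct) (simp_all add: assms provable_And_mono)

text \<open>
  The conjunction that refutes \<open>insert \<beta> x\<close> may contain \<open>\<beta>\<close> anywhere and any number of times.
  Substituting \<open>\<alpha>\<close> for all its occurrences keeps the shape of the conjunction, so \<open>\<beta>\<close> need not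
  be moved to the front, and monotonicity of conjunction suffices.
\<close>

lemma maximal_consistent_closed:
  assumes "proof_system \<Lambda>" "maximal_consistent \<Lambda> x" "\<alpha> \<in> x" "\<Lambda> \<turnstile> Imp \<alpha> \<beta>"
  shows "\<beta> \<in> x"
proof (rule ccontr)
  assume "\<beta> \<notin> x"
  then have "\<not> consistent \<Lambda> (insert \<beta> x)"
    using assms(2) by (auto simp: maximal_consistent_def)
  then obtain \<gamma> \<gamma>s where sub: "set (\<gamma> # \<gamma>s) \<subseteq> insert \<beta> x"
    and neg: "\<Lambda> \<turnstile> Neg (conj_list \<gamma> \<gamma>s)"
    by (auto simp: consistent_def)
  define f where "f = id(\<beta> := \<alpha>)"
  have "\<Lambda> \<turnstile> Imp (f \<delta>) \<delta>" for \<delta>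
    using assms(4) provable_Imp_refl[OF assms(1)] by (simp add: f_def)
  then have "\<Lambda> \<turnstile> Neg (conj_list (f \<gamma>) (map f \<gamma>s))"
    by (rule provable_modus_tollens[OF assms(1) provable_conj_list_mono[OF assms(1)] neg])
  moreover have "set (f \<gamma> # map f \<gamma>s) \<subseteq> x"
    using sub assms(3) by (auto simp: f_def)
  ultimately have "\<not> consistent \<Lambda> x"
    unfolding consistent_def by blast
  then show False
    using assms(2) by (simp add: maximal_consistent_def)
qed

lemma provable_RE_Delta:
  assumes "RE_Delta \<in> rules \<Lambda>" "\<Lambda> \<turnstile> Iff \<phi> \<psi>"
  shows "\<Lambda> \<turnstile> Iff (Delta \<phi>) (Delta \<psi>)"
proof (rule provable.rule[OF assms(1)])
  show "([Iff \<phi> \<psi>], Iff (Delta \<phi>) (Delta \<psi>)) \<in> RE_Delta"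
    by (auto simp: RE_Delta_def)
qed (use assms(2) in auto)

theorem proposition25:
  fixes \<Lambda> :: "'p calculus" and x :: "'p formula set" and \<phi> :: "'p formula"
  assumes "proof_system \<Lambda>"
    and "RE_Delta \<in> rules \<Lambda>"
    and "maximal_consistent \<Lambda> x"
  shows "(\<forall>\<psi>. \<Lambda> \<turnstile> Imp \<phi> \<psi> \<longrightarrow> Delta \<psi> \<in> x) \<longleftrightarrow> (\<forall>\<psi>. Delta (Or \<phi> \<psi>) \<in> x)"
proof
  assume "\<forall>\<psi>. \<Lambda> \<turnstile> Imp \<phi> \<psi> \<longrightarrow> Delta \<psi> \<in> x"
  then show "\<forall>\<psi>. Delta (Or \<phi> \<psi>) \<in> x"
    using provable_Imp_Or[OF assms(1)] by blast
next
  assume disj: "\<forall>\<psi>. Delta (Or \<phi> \<psi>) \<in> x"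
  show "\<forall>\<psi>. \<Lambda> \<turnstile> Imp \<phi> \<psi> \<longrightarrow> Delta \<psi> \<in> x"
  proof (intro allI impI)
    fix \<psi>
    assume "\<Lambda> \<turnstile> Imp \<phi> \<psi>"
    then have "\<Lambda> \<turnstile> Iff (Delta (Or \<phi> \<psi>)) (Delta \<psi>)"
      by (intro provable_RE_Delta assms(2) provable_Or_absorb assms(1))
    then have "\<Lambda> \<turnstile> Imp (Delta (Or \<phi> \<psi>)) (Delta \<psi>)"
      by (rule provable_Iff_Imp[OF assms(1)])
    with disj show "Delta \<psi> \<in> x"
      using maximal_consistent_closed[OF assms(1,3)] by blast
  qed
qed

end
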